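(* Let $d\ge 2$ be an integer, let $\mathbf{a}=(a_n)_{n=1}^\infty$ be a complex sequence with $a_n=n^{o(1)}$ as $n\to\infty$, and let $1/2<\alpha<1$. Then for any $k\in\{1,\ldots,d\}$ and any $$\boldsymbol{\omega}=(\omega_1,\ldots,\omega_k,0,\ldots,0)\in\mathbb{R}^d,\qquad \omega_k\ne 0,\quad \|\boldsymbol{\omega}\|=1,$$ we have $$\dim(\mathcal{E}_{\mathbf{a},d,\alpha}\cap L_{\boldsymbol{\omega}})\le 1-\frac{2\alpha-1}{k+1-\alpha},$$ where $L_{\boldsymbol{\omega}}=\{t\boldsymbol{\omega}: t\in[0,1]\}$.
   Context: $\dim$ is Hausdorff dimension, $\|\cdot\|$ is the Euclidean norm, $\mathbf{e}(x)=\exp(2\pi i x)$. $S_{\mathbf{a},d}(\mathbf{x};N)=\sum_{n=1}^N a_n\,\mathbf{e}(x_1n+x_2n^2+\ldots+x_dn^d)$, and $\mathcal{E}_{\mathbf{a},d,\alpha}$ is the set of $\mathbf{x}\in\mathsf{T}_d=(\mathbb{R}/\mathbb{Z})^d$ such that $|S_{\mathbf{a},d}(\mathbf{x};N)|\ge N^{\alpha}$ for infinitely many $N\in\mathbb{N}$. As $S_{\mathbf{a},d}$ is $\mathbb{Z}^d$-periodic in $\mathbf{x}$, points of $\mathbb{R}^d$ are taken modulo $\mathbb{Z}^d$: $\mathcal{E}_{\mathbf{a},d,\alpha}\cap L_{\boldsymbol{\omega}}$ is the set of $\mathbf{x}\in L_{\boldsymbol{\omega}}$ such that $|S_{\mathbf{a},d}(\mathbf{x};N)|\ge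 N^{\alpha}$ for infinitely many $N$. $U=V^{o(1)}$ means that for every $\varepsilon>0$, $|U|\le V^{\varepsilon}$ once $V$ is large enough. *)

theory Defs
  imports "HOL-Analysis.Analysis"
begin

section \<open>Hausdorff dimension\<close>

text \<open>
  The weight of a covering set. The case distinction fixes the conventions
  \<open>(diam {})^s = 0\<close> and \<open>(diam U)^0 = 1\<close> for nonempty \<open>U\<close>, so that the measure for
  \<open>s = 0\<close> is the counting measure (whereas \<open>0 powr 0 = 0\<close>).
\<close>

definition diam_weight :: "real \<Rightarrow> 'a::metric_space set \<Rightarrow> ennreal" where
  "diam_weight s U =
     (if U = {} then 0 else if s = 0 then 1 else ennreal (diameter U powr s))"

text \<open>
  The covering sets are required to be bounded because \<open>diameter\<close> is a real-valued supremum
  and carries no information on unbounded sets.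
\<close>

definition hausdorff_content :: "real \<Rightarrow> real \<Rightarrow> 'a::metric_space set \<Rightarrow> ennreal" where
  "hausdorff_content s \<delta> A =
     (INF U \<in> {U :: nat \<Rightarrow> 'a set. A \<subseteq> (\<Union>i. U i) \<and> (\<forall>i. bounded (U i) \<and> diameter (U i) \<le> \<delta>)}.
        \<Sum>i. diam_weight s (U i))"

definition hausdorff_measure :: "real \<Rightarrow> 'a::metric_space set \<Rightarrow> ennreal" where
  "hausdorff_measure s A = (SUP \<delta> \<in> {0<..}. hausdorff_content s \<delta> A)"

definition hausdorff_dim :: "'a::metric_space set \<Rightarrow> ereal" where
  "hausdorff_dim A = Inf {ereal s | s. 0 \<le> s \<and> hausdorff_measure s A = 0}"


section \<open>Weyl sums\<close>

text \<open>
  The space \<open>real ^ 'n\<close> with \<open>'n\<close> a finite linearly ordered type is Euclidean space of dimension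
  \<open>d = CARD('n)\<close>; the order on \<open>'n\<close> numbers the coordinates from \<open>1\<close> to \<open>d\<close>.
\<close>

definition nth_index :: "nat \<Rightarrow> 'n::{finite,linorder}" where
  "nth_index j = sorted_list_of_set UNIV ! (j - 1)"

definition coord :: "real ^ 'n::{finite,linorder} \<Rightarrow> nat \<Rightarrow> real" where
  "coord x j = x $ nth_index j"

lemma bij_betw_nth_index:
  "bij_betw (nth_index :: nat \<Rightarrow> 'n::{finite,linorder}) {1..CARD('n)} UNIV"
proof -
  have "bij_betw (\<lambda>j. j - 1) {1..CARD('n)} {..<CARD('n)}"
    by (rule bij_betwI[where g = Suc]) auto
  moreover have "bij_betw ((!) (sorted_list_of_set (UNIV :: 'n set))) {..<CARD('n)} UNIV"
    by (rule bij_betw_nth) auto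
  ultimately have "bij_betw ((!) (sorted_list_of_set (UNIV :: 'n set)) \<circ> (\<lambda>j. j - 1)) {1..CARD('n)} UNIV"
    by (rule bij_betw_trans)
  then show ?thesis
    by (simp add: nth_index_def[abs_def] comp_def)
qed

definition unit_exp :: "real \<Rightarrow> complex" where
  "unit_exp x = exp (2 * of_real pi * \<i> * of_real x)"

definition weyl_sum ::
    "(nat \<Rightarrow> complex) \<Rightarrow> real ^ 'n::{finite,linorder} \<Rightarrow> nat \<Rightarrow> complex" where
  "weyl_sum a x N = (\<Sum>n=1..N. a n * unit_exp (\<Sum>j=1..CARD('n). coord x j * real n ^ j))"

text \<open>
  Points of the torus are represented by all their lifts: the sums are periodic modulo
  integer vectors, so this is the full preimage of the exceptional set of the torus.
\<close>

definition large_sums :: "(nat \<Rightarrow> complex) \<Rightarrow> real \<Rightarrow> (real ^ 'n::{finite,linorder}) set" where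
  "large_sums a \<alpha> = {x. \<exists>\<^sub>\<infinity>N. norm (weyl_sum a x N) \<ge> real N powr \<alpha>}"

text \<open>\<open>a\<^sub>n = n\<^bsup>o(1)\<^esup>\<close>; the value \<open>a 0\<close> plays no role.\<close>

definition subpolynomial :: "(nat \<Rightarrow> complex) \<Rightarrow> bool" where
  "subpolynomial a \<longleftrightarrow>
     (\<forall>\<epsilon>>0. eventually (\<lambda>n. norm (a n) \<le> real n powr \<epsilon>) sequentially)"

definition segment_from_0 :: "'a::real_vector \<Rightarrow> 'a set" where
  "segment_from_0 \<omega> = {t *\<^sub>R \<omega> | t. t \<in> {0..1}}"

end

theory Submission
  imports Defs
begin

text \<open>
  On the segment the sum is \<open>\<Sum>a\<^sub>n e(t Q(n))\<close> with a real polynomial \<open>Q\<close> of degree \<open>k\<close>, whose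
  values are separated: \<open>\<bar>m - n\<bar>\<close> is at most a constant times \<open>1 + \<bar>Q(m) - Q(n)\<bar>\<close>. Expanding the
  square therefore bounds the mean square over \<open>[0, 1]\<close> of a block of length \<open>L\<close> below \<open>X\<close> by
  \<open>L X\<^bsup>o(1)\<^esup>\<close>. If a partial sum with \<open>N \<le> X = 2\<^sup>m\<close> terms is at least \<open>X\<^sup>\<alpha>\<close>, then some dyadic block is
  at least \<open>X\<^bsup>\<alpha> - o(1)\<^esup>\<close>. Since the sums have derivative \<open>O(X\<^bsup>k + 1 + o(1)\<^esup>)\<close>, the block stays large on the
  whole cell of a grid of mesh \<open>X\<^bsup>-(k + 1 - \<alpha>) - o(1)\<^esup>\<close>, so Chebyshev's inequality leaves at most
  \<open>X\<^bsup>k + 1 - \<alpha> + 1 - 2 \<alpha> + o(1)\<^esup>\<close> cells. These cells, over all \<open>m\<close>, cover the exceptional set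
  infinitely often, and their \<open>s\<close>-th powers are summable as soon as
  \<open>s > 1 - (2 \<alpha> - 1) / (k + 1 - \<alpha>)\<close>.
\<close>

section \<open>Covers and Hausdorff dimension\<close>

text \<open>A Hausdorff version of the Borel-Cantelli lemma: the levels from any \<open>m0\<close>
  on still cover \<open>A\<close>, and the weight of that cover is a tail of a convergent
  series.\<close>

lemma hausdorff_measure_zero_limsup_cover:
  fixes U :: "nat \<Rightarrow> nat \<Rightarrow> 'a::metric_space set" and J :: "nat \<Rightarrow> nat set"
  assumes s: "0 < s"
    and fin: "\<And>m. finite (J m)"
    and bdd: "\<And>m i. bounded (U m i)"
    and diam: "\<And>m i. i \<in> J m \<Longrightarrow> diameter (U m i) \<le> d m"
    and d: "d \<longlonglongrightarrow> 0" "\<And>m. 0 \<le> d m"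
    and summ: "summable (\<lambda>m. real (card (J m)) * d m powr s)"
    and cover: "\<And>x m0. x \<in> A \<Longrightarrow> \<exists>m\<ge>m0. \<exists>i\<in>J m. x \<in> U m i"
  shows "hausdorff_measure s A = 0"
proof -
  have *: "hausdorff_content s \<delta> A \<le> ennreal \<eta>" if "\<delta> > 0" "\<eta> > 0" for \<delta> \<eta> :: real
  proof -
    define w where "w m = real (card (J m)) * d m powr s" for m
    have w0: "0 \<le> w m" for m by (simp add: w_def)
    have "eventually (\<lambda>m. d m < \<delta>) sequentially"
      using d(1) \<open>\<delta> > 0\<close> by (rule order_tendstoD(2))
    then obtain m1 where m1: "\<And>m. m \<ge> m1 \<Longrightarrow> d m < \<delta>"
      by (auto simp: eventually_sequentially)
    obtain m2 where m2: "\<And>n. n \<ge> m2 \<Longrightarrow> norm (\<Sum>i. w (i + n)) < \<eta>"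
      using suminf_exist_split[of \<eta> w] summ \<open>\<eta> > 0\<close> unfolding w_def by auto
    define m0 where "m0 = max m1 m2"
    \<comment> \<open>\<open>hausdorff_content\<close> asks for a single sequence of sets, so the
      pairs (level, index) are enumerated by \<open>prod_decode\<close>. Indices outside
      \<open>J\<close> give the empty set, whose weight is 0 by convention.\<close>
    define f where "f = (\<lambda>(m, j). if j \<in> J (m + m0) then U (m + m0) j else {})"
    have sw: "summable (\<lambda>m. w (m + m0))"
      using summ unfolding w_def by (subst summable_iff_shift)
    have fcov: "A \<subseteq> (\<Union>i. f (prod_decode i))"
    proof
      fix x assume "x \<in> A"
      then obtain m i where "m \<ge> m0" "i \<in> J m" "x \<in> U m i" using cover by blast
      then have "x \<in> f (prod_decode (prod_encode (m - m0, i)))" by (simp add: f_def)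
      then show "x \<in> (\<Union>i. f (prod_decode i))" by blast
    qed
    have "diameter (U (m + m0) j) \<le> \<delta>" if "j \<in> J (m + m0)" for m j
      using diam[OF that] m1[of "m + m0"] by (simp add: m0_def max.coboundedI1 trans_le_add2)
    then have fb: "bounded (f p) \<and> diameter (f p) \<le> \<delta>" for p
      using bdd \<open>\<delta> > 0\<close> by (cases p) (simp add: f_def)
    have "hausdorff_content s \<delta> A \<le> (\<Sum>i. diam_weight s (f (prod_decode i)))"
      unfolding hausdorff_content_def using fcov fb by (intro INF_lower) auto
    also have "\<dots> = (\<Sum>m. \<Sum>j. diam_weight s (f (m, j)))"
      by (rule suminf_ennreal_2dimen[where f = "\<lambda>p. diam_weight s (f p)"]) simp
    also have "\<dots> \<le> (\<Sum>m. ennreal (w (m + m0)))"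
    proof (intro suminf_le)
      fix m
      have "(\<Sum>j. diam_weight s (f (m, j))) = (\<Sum>j\<in>J (m + m0). diam_weight s (f (m, j)))"
        using fin by (intro suminf_finite) (auto simp: f_def diam_weight_def)
      also have "\<dots> \<le> (\<Sum>j\<in>J (m + m0). ennreal (d (m + m0) powr s))"
        using s diam diameter_ge_0[OF bdd]
        by (intro sum_mono) (auto simp: f_def diam_weight_def intro!: ennreal_leI powr_mono2)
      also have "\<dots> = ennreal (w (m + m0))"
        by (simp add: w_def ennreal_mult' ennreal_of_nat_eq_real_of_nat)
      finally show "(\<Sum>j. diam_weight s (f (m, j))) \<le> ennreal (w (m + m0))" .
    qed auto
    also have "\<dots> = ennreal (\<Sum>m. w (m + m0))"
      using w0 sw by (intro suminf_ennreal2) auto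
    also have "\<dots> \<le> ennreal \<eta>"
      using m2[of m0] by (intro ennreal_leI) (auto simp: m0_def)
    finally show ?thesis .
  qed
  then have "hausdorff_content s \<delta> A = 0" if "\<delta> > 0" for \<delta>
  proof -
    have "hausdorff_content s \<delta> A \<le> 0"
    proof (rule ennreal_le_epsilon)
      show "hausdorff_content s \<delta> A \<le> 0 + ennreal e" if "0 < e" for e
        using * \<open>\<delta> > 0\<close> that by simp
    qed
    then show ?thesis by simp
  qed
  then show ?thesis by (simp add: hausdorff_measure_def)
qed

section \<open>Covers under non-expanding maps\<close>

lemma diameter_image_le:
  fixes f :: "'a::metric_space \<Rightarrow> 'b::metric_space"
  assumes lip: "\<And>x y. dist (f x) (f y) \<le> dist x y" and b: "bounded U"
  shows "bounded (f ` U)" "diameter (f ` U) \<le> diameter U"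
proof -
  from b obtain x e where "\<And>y. y \<in> U \<Longrightarrow> dist x y \<le> e" by (auto simp: bounded_def)
  then show "bounded (f ` U)"
    unfolding bounded_def using lip by (intro exI[of _ "f x"] exI[of _ e]) (auto intro: order.trans)
  show "diameter (f ` U) \<le> diameter U"
  proof (cases "U = {}")
    case False
    have "dist (f x) (f y) \<le> diameter U" if "x \<in> U" "y \<in> U" for x y
      using lip[of x y] diameter_bounded_bound[OF b that] by linarith
    then show ?thesis
      using False by (subst diameter_def) (auto intro!: cSUP_least)
  qed simp
qed

text \<open>The images of the sets of a cover of \<open>A\<close> cover \<open>B\<close> and have no
  larger diameters. Hence every exponent at which the measure of \<open>A\<close> vanishes is one
  for \<open>B\<close>, and the infimum can only drop.\<close>

lemma hausdorff_dim_lipschitz_image_le: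
  fixes f :: "'a::metric_space \<Rightarrow> 'b::metric_space"
  assumes lip: "\<And>x y. dist (f x) (f y) \<le> dist x y" and sub: "B \<subseteq> f ` A"
  shows "hausdorff_dim B \<le> hausdorff_dim A"
proof -
  have w: "diam_weight s (f ` U) \<le> diam_weight s U" if "bounded U" "0 \<le> s" for s U
    using diameter_image_le[OF lip that(1)] that diameter_ge_0
    by (auto simp: diam_weight_def intro!: ennreal_leI powr_mono2)
  have "hausdorff_content s \<delta> B \<le> hausdorff_content s \<delta> A" if "0 \<le> s" for s \<delta>
    unfolding hausdorff_content_def
  proof (rule INF_mono)
    fix U :: "nat \<Rightarrow> 'a set"
    assume U: "U \<in> {U. A \<subseteq> (\<Union>i. U i) \<and> (\<forall>i. bounded (U i) \<and> diameter (U i) \<le> \<delta>)}"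
    have "A \<subseteq> (\<Union>i. U i)" using U by simp
    then have "B \<subseteq> (\<Union>i. f ` U i)" using sub by (simp add: image_UN[symmetric] order.trans[OF _ image_mono])
    moreover have "bounded (f ` U i) \<and> diameter (f ` U i) \<le> \<delta>" for i
    proof -
      have "bounded (U i)" "diameter (U i) \<le> \<delta>" using U by auto
      then show ?thesis using diameter_image_le[OF lip, of "U i"] by simp
    qed
    moreover have "(\<Sum>i. diam_weight s (f ` U i)) \<le> (\<Sum>i. diam_weight s (U i))"
    proof (intro suminf_le w)
      show "bounded (U i)" for i using U by blast
    qed (use that in auto)
    ultimately show "\<exists>V\<in>{V. B \<subseteq> (\<Union>i. V i) \<and> (\<forall>i. bounded (V i) \<and> diameter (V i) \<le> \<delta>)}.
        (\<Sum>i. diam_weight s (V i)) \<le> (\<Sum>i. diam_weight s (U i))"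
      by (intro bexI[of _ "\<lambda>i. f ` U i"] CollectI conjI allI) auto
  qed
  then have "hausdorff_measure s B \<le> hausdorff_measure s A" if "0 \<le> s" for s
    unfolding hausdorff_measure_def using that by (intro SUP_mono) auto
  then show ?thesis
    unfolding hausdorff_dim_def by (intro Inf_superset_mono) (auto, metis le_zero_eq)
qed

text \<open>Only exponents close to \<open>s0\<close> matter. The upper end \<open>s1\<close> lets
  the application assume \<open>s < 1\<close>, where \<open>x powr (1 - s)\<close> is increasing in
  \<open>x\<close>.\<close>

lemma hausdorff_dim_leI:
  assumes "\<And>s. s0 < s \<Longrightarrow> s < s1 \<Longrightarrow> hausdorff_measure s A = 0" "0 \<le> s0" "s0 < s1"
  shows "hausdorff_dim A \<le> ereal s0"
proof (rule ereal_le_epsilon2)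
  fix e :: real assume "0 < e"
  define s where "s = s0 + min e ((s1 - s0) / 2)"
  have "s0 < s" "s < s1" "s \<le> s0 + e" using assms \<open>0 < e\<close> by (auto simp: s_def min_def field_simps)
  then have "hausdorff_dim A \<le> ereal s"
    unfolding hausdorff_dim_def using assms by (intro Inf_lower) auto
  also have "\<dots> \<le> ereal s0 + ereal e" using \<open>s \<le> s0 + e\<close> by simp
  finally show "hausdorff_dim A \<le> ereal s0 + ereal e" .
qed

section \<open>Exponential sums on the unit interval\<close>

lemma norm_unit_exp [simp]: "norm (unit_exp x) = 1"
  by (simp add: unit_exp_def)

lemma unit_exp_add: "unit_exp (x + y) = unit_exp x * unit_exp y"
  by (simp add: unit_exp_def distrib_left exp_add)

lemma unit_exp_mult_cnj: "unit_exp x * cnj (unit_exp y) = unit_exp (x - y)"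
proof -
  have "cnj (unit_exp y) = unit_exp (- y)" by (simp add: unit_exp_def exp_cnj)
  then show ?thesis using unit_exp_add[of x "- y"] by simp
qed

lemma continuous_on_unit_exp [continuous_intros]:
  "continuous_on S f \<Longrightarrow> continuous_on S (\<lambda>x. unit_exp (f x))"
  unfolding unit_exp_def by (intro continuous_intros)

text \<open>A chord is no longer than its arc: factoring out \<open>unit_exp y\<close> leaves the
  modulus \<open>2 * \<bar>sin (pi * (x - y))\<bar>\<close>.\<close>

lemma norm_unit_exp_diff_le: "norm (unit_exp x - unit_exp y) \<le> 2 * pi * \<bar>x - y\<bar>"
proof -
  have "unit_exp x - unit_exp y = unit_exp y * (exp (\<i> * of_real (2 * pi * (x - y))) - 1)"
  proof -
    have "unit_exp (x - y) = exp (\<i> * of_real (2 * pi * (x - y)))"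
      by (simp add: unit_exp_def mult_ac)
    then show ?thesis
      using unit_exp_add[of y "x - y"] by (simp only: right_diff_distrib mult_1_right) simp
  qed
  then have "norm (unit_exp x - unit_exp y) = 2 * \<bar>sin (pi * (x - y))\<bar>"
    using dist_exp_i_1[of "2 * pi * (x - y)"] by (simp add: norm_mult)
  also have "\<dots> \<le> 2 * \<bar>pi * (x - y)\<bar>"
    using abs_sin_x_le_abs_x by (intro mult_left_mono) auto
  finally show ?thesis by (simp add: abs_mult)
qed

text \<open>For \<open>\<bar>x\<bar> \<le> 1\<close> the trivial bound 1 suffices; otherwise the
  antiderivative gives \<open>2 / (2 * pi * \<bar>x\<bar>)\<close>. The denominator
  \<open>1 + \<bar>x\<bar>\<close> merges both regimes and matches the separation hypothesis on the
  phases.\<close>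

lemma norm_integral_unit_exp_le:
  "norm (integral {0..1} (\<lambda>t. unit_exp (t * x))) \<le> 2 / (1 + \<bar>x\<bar>)"
proof (cases "\<bar>x\<bar> \<le> 1")
  case True
  have "norm (integral {0..1} (\<lambda>t. unit_exp (t * x))) \<le> integral {0..1::real} (\<lambda>t. 1)"
    by (intro integral_norm_bound_integral integrable_continuous_real continuous_intros) auto
  also have "\<dots> \<le> 2 / (1 + \<bar>x\<bar>)" using True by (simp add: field_simps)
  finally show ?thesis .
next
  case False
  define c where "c = 2 * of_real pi * \<i> * of_real x"
  have c: "c \<noteq> 0" "norm c = 2 * pi * \<bar>x\<bar>" using False by (auto simp: c_def norm_mult)
  have "((\<lambda>t. exp (c * of_real t)) has_integral (exp (c * of_real 1) / c - exp (c * of_real 0) / c)) {0..1}"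
  proof (rule fundamental_theorem_of_calculus)
    fix t :: real
    have "((\<lambda>z. exp (c * z) / c) has_field_derivative exp (c * of_real t)) (at (of_real t))"
      using c(1) by (auto intro!: derivative_eq_intros)
    then show "((\<lambda>t. exp (c * of_real t) / c) has_vector_derivative exp (c * of_real t)) (at t within {0..1})"
      by (rule has_vector_derivative_at_within[OF has_vector_derivative_real_field])
  qed simp
  moreover have "exp (c * of_real t) = unit_exp (t * x)" for t
    by (simp add: unit_exp_def c_def mult_ac)
  ultimately have "integral {0..1} (\<lambda>t. unit_exp (t * x)) = (exp c - 1) / c"
    by (simp add: integral_unique diff_divide_distrib)
  then have "norm (integral {0..1} (\<lambda>t. unit_exp (t * x))) = norm (exp c - 1) / (2 * pi * \<bar>x\<bar>)"
    by (simp add: norm_divide c)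
  moreover have "norm (exp c - 1) \<le> 1 + 1"
    by (rule order.trans[OF norm_triangle_ineq4]) (simp add: c_def)
  moreover have "2 / (2 * pi * \<bar>x\<bar>) \<le> 2 / (1 + \<bar>x\<bar>)"
  proof (rule divide_left_mono)
    have "2 * \<bar>x\<bar> \<le> 2 * pi * \<bar>x\<bar>" using pi_gt3 by (intro mult_right_mono) auto
    then show "1 + \<bar>x\<bar> \<le> 2 * pi * \<bar>x\<bar>" using False by linarith
  qed (use False in \<open>auto intro!: mult_pos_pos add_pos_nonneg\<close>)
  ultimately show ?thesis
    using divide_right_mono[of "norm (exp c - 1)" 2 "2 * pi * \<bar>x\<bar>"] by simp
qed

section \<open>Mean squares of blocks\<close>

lemma harm_le_ln: "harm (Suc n) \<le> 1 + ln (real (Suc n))"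
  using decseqD[OF decseq_harm_diff_ln, of 0 n] by (simp add: harm_Suc harm_expand(1))

lemma harm_power2_le: "harm (2 ^ j) \<le> real j + 1"
proof -
  have "harm (2 ^ j) \<le> 1 + ln (2 ^ j :: real)"
    using harm_le_ln[of "2 ^ j - 1"] by simp
  also have "ln (2 ^ j :: real) \<le> real j * 1"
    using ln_2_less_1 by (simp add: ln_realpow mult_left_le)
  finally show ?thesis by simp
qed

text \<open>On either side of \<open>m\<close> the distances to \<open>m\<close> are distinct
  integers below \<open>L\<close>, so each side contributes at most one harmonic sum.\<close>

lemma sum_inverse_dist_le:
  fixes m u L :: nat
  assumes "m \<in> {u..<u + L}"
  shows "(\<Sum>n\<in>{u..<u + L}. 1 / (1 + \<bar>real m - real n\<bar>)) \<le> 2 * harm L"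
proof -
  let ?f = "\<lambda>n. 1 / (1 + \<bar>real m - real n\<bar>)"
  have aux: "sum ?f S \<le> harm L"
    if S: "finite S" and inj: "inj_on h S" and h: "\<And>n. n \<in> S \<Longrightarrow> h n < L \<and> \<bar>real m - real n\<bar> = real (h n)"
    for S :: "nat set" and h :: "nat \<Rightarrow> nat"
  proof -
    have "sum ?f S = (\<Sum>n\<in>S. inverse (real (Suc (h n))))"
      using h by (intro sum.cong) (auto simp: field_simps)
    also have "\<dots> = (\<Sum>i\<in>h ` S. inverse (real (Suc i)))"
      using inj by (simp add: sum.reindex)
    also have "\<dots> \<le> (\<Sum>i<L. inverse (real (Suc i)))"
      using h by (intro sum_mono2) auto
    finally show ?thesis by (simp add: harm_altdef)
  qed
  have "{u..<u + L} = {u..m} \<union> {m<..<u + L}" using assms by auto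
  then have "sum ?f {u..<u + L} = sum ?f {u..m} + sum ?f {m<..<u + L}"
    by (simp only:, intro sum.union_disjoint) auto
  also have "\<dots> \<le> harm L + harm L"
    using assms
    by (intro add_mono aux[where h = "\<lambda>n. m - n"] aux[where h = "\<lambda>n. n - m"])
       (auto simp: inj_on_def)
  finally show ?thesis by simp
qed

text \<open>In the expanded square the pair \<open>(m, n)\<close> carries an oscillatory integral of
  size at most \<open>2 / (1 + \<bar>q m - q n\<bar>)\<close>. Separation turns this into decay in
  \<open>\<bar>m - n\<bar>\<close>, so a row of the double sum costs a harmonic sum instead of
  \<open>L\<close>.\<close>

lemma mean_square_le:
  fixes b :: "nat \<Rightarrow> complex" and q :: "nat \<Rightarrow> real"
  assumes sep: "\<And>m n. 1 + \<bar>real m - real n\<bar> \<le> C * (1 + \<bar>q m - q n\<bar>)"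
    and b: "\<And>n. n \<in> {u..<u + L} \<Longrightarrow> norm (b n) \<le> A" and A: "0 \<le> A"
  shows "integral {0..1} (\<lambda>t. (norm (\<Sum>n\<in>{u..<u + L}. b n * unit_exp (t * q n)))\<^sup>2)
           \<le> 4 * C * A\<^sup>2 * real L * harm L"
proof -
  let ?B = "{u..<u + L}"
  let ?S = "\<lambda>t. \<Sum>n\<in>?B. b n * unit_exp (t * q n)"
  let ?I = "\<lambda>m n. integral {0..1} (\<lambda>t. unit_exp (t * (q m - q n)))"
  have C: "0 < C" using sep[of 0 0] by simp
  \<comment> \<open>The complex-valued form can be expanded and integrated term by term; the real
    integral is recovered at the end through \<open>of_real\<close>.\<close>
  have sq: "complex_of_real ((norm (?S t))\<^sup>2) =
      (\<Sum>m\<in>?B. \<Sum>n\<in>?B. b m * cnj (b n) * unit_exp (t * (q m - q n)))" for t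
  proof -
    have "complex_of_real ((norm (?S t))\<^sup>2) = ?S t * cnj (?S t)"
      by (rule complex_norm_square)
    also have "\<dots> = (\<Sum>m\<in>?B. \<Sum>n\<in>?B. (b m * unit_exp (t * q m)) * cnj (b n * unit_exp (t * q n)))"
      by (simp add: sum_product)
    also have "\<dots> = (\<Sum>m\<in>?B. \<Sum>n\<in>?B. b m * cnj (b n) * unit_exp (t * (q m - q n)))"
      by (intro sum.cong refl) (simp add: right_diff_distrib unit_exp_mult_cnj[symmetric] mult_ac)
    finally show ?thesis .
  qed
  have "integral {0..1} (\<lambda>t. complex_of_real ((norm (?S t))\<^sup>2))
      = (\<Sum>m\<in>?B. integral {0..1} (\<lambda>t. \<Sum>n\<in>?B. b m * cnj (b n) * unit_exp (t * (q m - q n))))"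
    unfolding sq by (intro integral_sum integrable_continuous_real continuous_intros) auto
  also have "\<dots> = (\<Sum>m\<in>?B. \<Sum>n\<in>?B. integral {0..1} (\<lambda>t. b m * cnj (b n) * unit_exp (t * (q m - q n))))"
    by (intro sum.cong refl integral_sum integrable_continuous_real continuous_intros) auto
  also have "\<dots> = (\<Sum>m\<in>?B. \<Sum>n\<in>?B. b m * cnj (b n) * ?I m n)"
    by simp
  finally have eq: "integral {0..1} (\<lambda>t. complex_of_real ((norm (?S t))\<^sup>2))
      = (\<Sum>m\<in>?B. \<Sum>n\<in>?B. b m * cnj (b n) * ?I m n)" .
  have summand: "norm (b m * cnj (b n) * ?I m n) \<le> 2 * C * A\<^sup>2 * (1 / (1 + \<bar>real m - real n\<bar>))"
    if "m \<in> ?B" "n \<in> ?B" for m n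
  proof -
    have "norm (?I m n) \<le> 2 / (1 + \<bar>q m - q n\<bar>)" by (rule norm_integral_unit_exp_le)
    also have "\<dots> \<le> 2 * C / (1 + \<bar>real m - real n\<bar>)"
      using sep[of m n] C by (simp add: divide_simps add_pos_nonneg algebra_simps)
    finally have "norm (b m) * norm (b n) * norm (?I m n) \<le> A * A * (2 * C / (1 + \<bar>real m - real n\<bar>))"
      using b[OF that(1)] b[OF that(2)] A by (intro mult_mono) auto
    then show ?thesis by (simp add: norm_mult power2_eq_square mult_ac)
  qed
  have "(\<lambda>t. (norm (?S t))\<^sup>2) integrable_on {0..1}"
    by (intro integrable_continuous_real continuous_intros)
  then have "integral {0..1} (\<lambda>t. complex_of_real ((norm (?S t))\<^sup>2))
      = complex_of_real (integral {0..1} (\<lambda>t. (norm (?S t))\<^sup>2))"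
    using integral_linear[OF _ bounded_linear_of_real] unfolding o_def by blast
  then have "integral {0..1} (\<lambda>t. (norm (?S t))\<^sup>2)
      \<le> norm (integral {0..1} (\<lambda>t. complex_of_real ((norm (?S t))\<^sup>2)))"
    by (simp only: norm_of_real abs_ge_self)
  also have "\<dots> \<le> (\<Sum>m\<in>?B. \<Sum>n\<in>?B. 2 * C * A\<^sup>2 * (1 / (1 + \<bar>real m - real n\<bar>)))"
    unfolding eq by (intro order.trans[OF norm_sum] sum_mono summand) auto
  also have "\<dots> = (\<Sum>m\<in>?B. 2 * C * A\<^sup>2 * (\<Sum>n\<in>?B. 1 / (1 + \<bar>real m - real n\<bar>)))"
    by (simp add: sum_distrib_left)
  also have "\<dots> \<le> (\<Sum>m\<in>?B. 2 * C * A\<^sup>2 * (2 * harm L))"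
    using C by (intro sum_mono mult_left_mono sum_inverse_dist_le) auto
  also have "\<dots> = 4 * C * A\<^sup>2 * real L * harm L" by simp
  finally show ?thesis .
qed

text \<open>Chebyshev's inequality on a grid: a cell of \<open>G\<close> has length
  \<open>1 / real K\<close> and so carries at least \<open>v / real K\<close> of the
  integral.\<close>

lemma card_mult_le_integral:
  fixes F :: "real \<Rightarrow> real"
  assumes cont: "continuous_on {0..1} F" and pos: "\<And>t. 0 \<le> F t"
    and G: "G \<subseteq> {..<K}"
    and low: "\<And>i t. i \<in> G \<Longrightarrow> t \<in> {real i / real K..(real i + 1) / real K} \<Longrightarrow> v \<le> F t"
  shows "real (card G) * v \<le> real K * integral {0..1} F"
proof (cases "K = 0")
  case False
  then have K: "0 < real K" by simp
  have intg: "F integrable_on {x..y}" if "0 \<le> x" "y \<le> 1" for x y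
    using that by (intro integrable_continuous_real continuous_on_subset[OF cont]) auto
  have le1: "real i / real K \<le> 1" if "i \<le> K" for i using that K by simp
  \<comment> \<open>The cells are added one at a time from the left, which needs the claim for the
    first \<open>i\<close> cells.\<close>
  have "real (card (G \<inter> {..<i})) * v \<le> real K * integral {0..real i / real K} F" if "i \<le> K" for i
    using that
  proof (induction i)
    case (Suc i)
    let ?J = "{real i / real K..(real i + 1) / real K}"
    have split: "integral {0..real (Suc i) / real K} F = integral {0..real i / real K} F + integral ?J F"
      using Suc.prems K le1[OF Suc.prems]
      by (subst Henstock_Kurzweil_Integration.integral_combine[where c = "real i / real K", symmetric])
         (auto intro!: intg divide_right_mono simp: add_ac)
    have ig: "F integrable_on ?J" using le1[OF Suc.prems] by (intro intg) (auto simp: add_ac)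
    have "(if i \<in> G then v else 0) \<le> real K * integral ?J F"
    proof (cases "i \<in> G")
      case True
      have "integral ?J (\<lambda>_. v) \<le> integral ?J F"
        using low[OF True] ig by (intro integral_le) auto
      moreover have "real K * integral ?J (\<lambda>_. v) = v"
        using K by (simp add: field_simps)
      moreover have "real K * integral ?J (\<lambda>_. v) \<le> real K * integral ?J F"
        using calculation(1) K by (intro mult_left_mono) auto
      ultimately show ?thesis using True by (simp only: if_True)
    next
      case False
      then show ?thesis using K pos ig by (simp add: integral_nonneg)
    qed
    moreover have "real (card (G \<inter> {..<Suc i})) * v = real (card (G \<inter> {..<i})) * v + (if i \<in> G then v else 0)"
      by (simp add: lessThan_Suc Int_insert_right algebra_simps)
    moreover have "real (card (G \<inter> {..<i})) * v \<le> real K * integral {0..real i / real K} F"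
      using Suc by simp
    ultimately show ?case
      unfolding split distrib_left by linarith
  qed simp
  from this[of K] show ?thesis using G False by (simp add: Int_absorb2)
qed (use G in auto)

text \<open>The Rademacher-Menshov device: an initial segment is a disjoint union of at most one dyadic
  block of each length.\<close>

lemma norm_sum_less_dyadic:
  fixes f :: "nat \<Rightarrow> 'a::real_normed_vector"
  assumes block: "\<And>j i. j \<le> M \<Longrightarrow> i < 2 ^ (M - j) \<Longrightarrow> norm (sum f {i * 2 ^ j..<i * 2 ^ j + 2 ^ j}) < \<theta>"
    and "m \<le> M" "i < 2 ^ (M - m)" "N \<le> 2 ^ m"
  shows "norm (sum f {i * 2 ^ m..<i * 2 ^ m + N}) < (real m + 1) * \<theta>"
  using assms(2-)
proof (induction m arbitrary: i N)
  case 0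
  \<comment> \<open>Norms are nonnegative, so any block yields positivity; the strict inequality for
    the empty sum needs it.\<close>
  have "0 < \<theta>" using block[of 0 i] 0 by (metis norm_ge_zero order_le_less_trans)
  with block[of 0 i] 0 show ?case by (cases "N = 0") (auto simp: le_Suc_eq)
next
  case (Suc m)
  have e: "M - m = Suc (M - Suc m)" using Suc.prems by simp
  have i: "2 * i < 2 ^ (M - m)" "2 * i + 1 < 2 ^ (M - m)" using Suc.prems(2) unfolding e by simp_all
  have l: "0 < \<theta>" using block[of "Suc m" i] Suc.prems by (metis norm_ge_zero order_le_less_trans)
  \<comment> \<open>Block \<open>i\<close> of level \<open>Suc m\<close> consists of the blocks
    \<open>2 * i\<close> and \<open>2 * i + 1\<close> of level \<open>m\<close>. A segment that
    leaves the first half uses it whole, at the cost of one \<theta>, and continues as an initial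
    segment of the second half.\<close>
  show ?case
  proof (cases "N \<le> 2 ^ m")
    case True
    have "norm (sum f {2 * i * 2 ^ m..<2 * i * 2 ^ m + N}) < (real m + 1) * \<theta>"
      using Suc True i by (intro Suc.IH) auto
    then show ?thesis using l by (simp add: algebra_simps)
  next
    case False
    let ?a = "2 * i * 2 ^ m" let ?b = "(2 * i + 1) * 2 ^ m :: nat"
    have ab: "?b = ?a + 2 ^ m" by (simp add: algebra_simps)
    have "sum f {?a..<?a + N} = sum f {?a..<?b} + sum f {?b..<?b + (N - 2 ^ m)}"
      using False unfolding ab by (subst sum.atLeastLessThan_concat) auto
    then have "norm (sum f {?a..<?a + N}) \<le> norm (sum f {?a..<?b}) + norm (sum f {?b..<?b + (N - 2 ^ m)})"
      by (simp add: norm_triangle_ineq)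
    moreover have "norm (sum f {?a..<?b}) < \<theta>"
      using block[of m "2 * i"] i Suc.prems unfolding ab by simp
    moreover have "norm (sum f {?b..<?b + (N - 2 ^ m)}) < (real m + 1) * \<theta>"
      using Suc.prems i by (intro Suc.IH) auto
    ultimately show ?thesis by (simp add: algebra_simps)
  qed
qed

section \<open>Polynomial phases\<close>

text \<open>For large arguments the derivative stays away from 0, so the mean value theorem gives
  differences of linear size. The finitely many small arguments only change the constant, and a
  negative leading coefficient is removed by passing to \<open>- Q\<close>.\<close>

lemma poly_separation:
  fixes Q :: "real poly"
  assumes "degree Q \<noteq> 0"
  obtains C where "\<And>m n :: nat. 1 + \<bar>real m - real n\<bar> \<le> C * (1 + \<bar>poly Q (real m) - poly Q (real n)\<bar>)"
proof -
  have pos: "\<exists>C. \<forall>m n :: nat. 1 + \<bar>real m - real n\<bar> \<le> C * (1 + \<bar>poly P (real m) - poly P (real n)\<bar>)"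
    if deg: "degree P \<noteq> 0" and lc: "lead_coeff P > 0" for P :: "real poly"
  proof -
    have "lead_coeff (pderiv P) > 0"
      using deg lc by (cases "degree P") (auto simp: degree_pderiv coeff_pderiv)
    then obtain x0 c where c: "c > 0" and x0: "\<And>x. x \<ge> x0 \<Longrightarrow> c \<le> poly (pderiv P) x"
      using poly_pinfty_gt_lc by blast
    define n0 where "n0 = nat \<lceil>x0\<rceil>"
    have n0: "x0 \<le> real n0" unfolding n0_def by (rule real_nat_ceiling_ge)
    have up: "c * (real n - real m) \<le> poly P (real n) - poly P (real m)"
      if "n0 \<le> m" "m \<le> n" for m n
    proof (cases "m = n")
      case False
      then have "real m < real n" using that by simp
      then obtain x where "real m < x"
        "poly P (real n) - poly P (real m) = (real n - real m) * poly (pderiv P) x"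
        using poly_MVT by blast
      moreover have "c \<le> poly (pderiv P) x"
        using \<open>real m < x\<close> n0 that by (intro x0) linarith
      ultimately show ?thesis
        using that by (simp add: mult_right_mono mult.commute[of c] mult_left_mono)
    qed simp
    have far: "c * \<bar>real m - real n\<bar> \<le> \<bar>poly P (real m) - poly P (real n)\<bar>"
      if "n0 \<le> m" "n0 \<le> n" for m n
      using up[of m n] up[of n m] that by (cases "m \<le> n") (auto simp: abs_if)
    \<comment> \<open>\<open>D\<close> bounds the change in value when an argument is raised to at
      least \<open>n0\<close>; arguments above \<open>n0\<close> do not move.\<close>
    define D where "D = Max ((\<lambda>n. \<bar>poly P (real n) - poly P (real (max n n0))\<bar>) ` {..n0})"
    have D: "\<bar>poly P (real n) - poly P (real (max n n0))\<bar> \<le> D" for n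
    proof (cases "n \<le> n0")
      case True
      then show ?thesis unfolding D_def by (intro Max_ge) auto
    next
      case False
      then have "max n n0 = n" by simp
      moreover have "0 \<le> D"
        unfolding D_def by (subst Max_ge_iff) (auto intro: exI[of _ n0])
      ultimately show ?thesis by simp
    qed
    have "D \<ge> 0" using D[of 0] by linarith
    \<comment> \<open>Here \<open>1 / c\<close> is the reciprocal slope, \<open>2 * real n0\<close>
      pays for moving both arguments, and \<open>2 * D / c\<close> for the change of both
      values.\<close>
    define C where "C = 1 + 1 / c + 2 * real n0 + 2 * D / c"
    have "1 + \<bar>real m - real n\<bar> \<le> C * (1 + \<bar>poly P (real m) - poly P (real n)\<bar>)" for m n
    proof -
      define X where "X = \<bar>poly P (real m) - poly P (real n)\<bar>"
      have "X \<ge> 0" by (simp add: X_def)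
      have tri: "\<bar>y' - z'\<bar> \<le> \<bar>y - z\<bar> + (\<bar>y - y'\<bar> + \<bar>z - z'\<bar>)" for y z y' z' :: real
        by linarith
      have "c * \<bar>real (max m n0) - real (max n n0)\<bar> \<le> X + (D + D)"
        unfolding X_def by (rule order.trans[OF far order.trans[OF tri add_mono[OF order.refl add_mono[OF D D]]]]) auto
      then have "\<bar>real (max m n0) - real (max n n0)\<bar> \<le> X / c + 2 * D / c"
        using c by (simp add: divide_simps mult.commute)
      moreover have "\<bar>real m - real n\<bar> \<le> \<bar>real (max m n0) - real (max n n0)\<bar> + 2 * real n0"
        by (auto simp: max_def)
      moreover have "0 \<le> 2 * D / c" "X / c = 1 / c * X" using \<open>D \<ge> 0\<close> c by simp_all
      moreover have "C * (1 + X) = C + X + 1 / c * X + 2 * real n0 * X + 2 * D / c * X"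
        unfolding C_def by (simp add: algebra_simps add_divide_distrib)
      moreover have "0 \<le> 2 * real n0 * X" "0 \<le> 2 * D / c * X" "0 \<le> 1 / c"
        using \<open>X \<ge> 0\<close> \<open>D \<ge> 0\<close> c by (auto intro!: mult_nonneg_nonneg divide_nonneg_nonneg)
      moreover have "C = 1 + 1 / c + 2 * real n0 + 2 * D / c" by (fact C_def)
      ultimately show ?thesis unfolding X_def[symmetric] using \<open>X \<ge> 0\<close> by linarith
    qed
    then show ?thesis by blast
  qed
  show ?thesis
  proof (cases "lead_coeff Q > 0")
    case True
    then show ?thesis using pos[of Q] assms that by blast
  next
    case False
    moreover have "lead_coeff Q \<noteq> 0" using assms by fastforce
    ultimately have "lead_coeff (- Q) > 0" unfolding lead_coeff_minus by linarith
    moreover have "degree (- Q) \<noteq> 0" using assms by simp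
    ultimately obtain C where "\<forall>m n :: nat. 1 + \<bar>real m - real n\<bar> \<le> C * (1 + \<bar>poly (- Q) (real m) - poly (- Q) (real n)\<bar>)"
      using pos by blast
    then show ?thesis by (intro that[of C]) (simp add: abs_minus_commute)
  qed
qed

lemma poly_nat_bound:
  fixes Q :: "real poly"
  obtains B where "0 \<le> B" "\<And>n X. 1 \<le> X \<Longrightarrow> real n \<le> X \<Longrightarrow> \<bar>poly Q (real n)\<bar> \<le> B * X ^ degree Q"
proof
  let ?B = "\<Sum>i\<le>degree Q. \<bar>coeff Q i\<bar>"
  show "0 \<le> ?B" by (simp add: sum_nonneg)
  fix n :: nat and X :: real assume X: "1 \<le> X" "real n \<le> X"
  have "\<bar>poly Q (real n)\<bar> \<le> (\<Sum>i\<le>degree Q. \<bar>coeff Q i * real n ^ i\<bar>)"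
    unfolding poly_altdef by (rule sum_abs)
  also have "\<dots> \<le> (\<Sum>i\<le>degree Q. \<bar>coeff Q i\<bar> * X ^ degree Q)"
  proof (intro sum_mono)
    fix i assume "i \<in> {..degree Q}"
    then have "real n ^ i \<le> X ^ degree Q"
      using X by (intro order.trans[OF power_mono power_increasing]) auto
    then show "\<bar>coeff Q i * real n ^ i\<bar> \<le> \<bar>coeff Q i\<bar> * X ^ degree Q"
      by (simp add: abs_mult mult_left_mono)
  qed
  also have "\<dots> = ?B * X ^ degree Q" by (simp add: sum_distrib_right)
  finally show "\<bar>poly Q (real n)\<bar> \<le> ?B * X ^ degree Q" .
qed

text \<open>A large partial sum forces a large dyadic block at the same \<open>t\<close>, which
  removes the dependence on \<open>N\<close>. By \<open>mesh\<close> the block stays above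
  \<open>\<theta> / 2\<close> on the whole cell. One factor \<open>real m + 1\<close> counts the
  levels, the other bounds the harmonic sum; 16 is the 4 of \<open>mean_square_le\<close> times the
  4 from halving \<theta>.\<close>

lemma card_grid_le:
  fixes b :: "nat \<Rightarrow> complex" and q :: "nat \<Rightarrow> real"
  assumes sep: "\<And>m n. 1 + \<bar>real m - real n\<bar> \<le> C * (1 + \<bar>q m - q n\<bar>)"
    and b: "\<And>n. n < 2 ^ m \<Longrightarrow> norm (b n) \<le> A" and q: "\<And>n. n < 2 ^ m \<Longrightarrow> \<bar>q n\<bar> \<le> B"
    and \<theta>: "0 < \<theta>" and K: "0 < K" and mesh: "4 * pi * A * B * 2 ^ m \<le> real K * \<theta>"
    and G: "G = {l \<in> {..<K}. \<exists>t\<in>{real l / real K..(real l + 1) / real K}. \<exists>N\<le>2 ^ m.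
              (real m + 1) * \<theta> \<le> norm (\<Sum>n<N. b n * unit_exp (t * q n))}"
  shows "real (card G) * \<theta>\<^sup>2 \<le> real K * (16 * C * A\<^sup>2 * 2 ^ m * (real m + 1)\<^sup>2)"
proof -
  have A: "0 \<le> A" by (rule order.trans[OF norm_ge_zero b[of 0]]) simp
  have B: "0 \<le> B" by (rule order.trans[OF abs_ge_zero q[of 0]]) simp
  have C: "0 < C" using sep[of 0 0] by simp
  let ?I = "\<lambda>l. {real l / real K..(real l + 1) / real K}"
  define S where "S j i t = (\<Sum>n\<in>{i * 2 ^ j..<i * 2 ^ j + 2 ^ j}. b n * unit_exp (t * q n))" for j i t
  define H where "H j i = {l \<in> {..<K}. \<exists>t\<in>?I l. \<theta> \<le> norm (S j i t)}" for j i
  have sub: "G \<subseteq> (\<Union>j\<le>m. \<Union>i<2 ^ (m - j). H j i)"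
  proof
    fix l assume "l \<in> G"
    then obtain t N where l: "l < K" "t \<in> ?I l" "N \<le> 2 ^ m"
      and big: "(real m + 1) * \<theta> \<le> norm (\<Sum>n<N. b n * unit_exp (t * q n))"
      by (auto simp: G)
    have "\<not> (\<forall>j\<le>m. \<forall>i<2 ^ (m - j). norm (S j i t) < \<theta>)"
    proof
      assume "\<forall>j\<le>m. \<forall>i<2 ^ (m - j). norm (S j i t) < \<theta>"
      then have "norm (\<Sum>n\<in>{0 * 2 ^ m..<0 * 2 ^ m + N}. b n * unit_exp (t * q n)) < (real m + 1) * \<theta>"
        unfolding S_def using l(3) by (intro norm_sum_less_dyadic[where M = m]) auto
      with big show False by (simp add: atLeast0LessThan)
    qed
    then obtain j i where "j \<le> m" "i < 2 ^ (m - j)" "\<theta> \<le> norm (S j i t)"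
      by (auto simp: not_less)
    moreover from this have "l \<in> H j i" using l(1,2) unfolding H_def by blast
    ultimately show "l \<in> (\<Union>j\<le>m. \<Union>i<2 ^ (m - j). H j i)" by blast
  qed
  have cardH: "real (card (H j i)) * \<theta>\<^sup>2 \<le> real K * (16 * C * A\<^sup>2 * (real m + 1)) * 2 ^ j"
    if ji: "j \<le> m" "i < 2 ^ (m - j)" for j i
  proof -
    let ?D = "{i * 2 ^ j..<i * 2 ^ j + 2 ^ j}"
    have "(i + 1) * 2 ^ j \<le> 2 ^ (m - j) * 2 ^ j" using ji by (intro mult_right_mono) auto
    then have le: "i * 2 ^ j + 2 ^ j \<le> 2 ^ m" using ji by (simp add: power_add[symmetric])
    \<comment> \<open>Each of the at most \<open>2 ^ m\<close> terms is Lipschitz in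
      \<open>t\<close> with constant \<open>2 * pi * A * B\<close>, and \<open>mesh\<close> was
      chosen to make the total change across a cell at most half the threshold.\<close>
    have lip: "norm (S j i t - S j i t') \<le> \<theta> / 2" if "\<bar>t - t'\<bar> \<le> 1 / real K" for t t'
    proof -
      have "norm (S j i t - S j i t') \<le> (\<Sum>n\<in>?D. norm (b n * (unit_exp (t * q n) - unit_exp (t' * q n))))"
        unfolding S_def by (simp add: sum_subtractf[symmetric] right_diff_distrib sum_norm_le)
      also have "\<dots> \<le> (\<Sum>n\<in>?D. A * (2 * pi * (B * (1 / real K))))"
      proof (intro sum_mono)
        fix n assume "n \<in> ?D"
        then have n: "n < 2 ^ m" using le by simp
        have "norm (unit_exp (t * q n) - unit_exp (t' * q n)) \<le> 2 * pi * \<bar>t * q n - t' * q n\<bar>"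
          by (rule norm_unit_exp_diff_le)
        also have "\<bar>t * q n - t' * q n\<bar> = \<bar>q n\<bar> * \<bar>t - t'\<bar>"
          by (simp add: abs_mult[symmetric] algebra_simps)
        also have "2 * pi * (\<bar>q n\<bar> * \<bar>t - t'\<bar>) \<le> 2 * pi * (B * (1 / real K))"
          using q[OF n] that B by (intro mult_left_mono mult_mono) auto
        finally show "norm (b n * (unit_exp (t * q n) - unit_exp (t' * q n))) \<le> A * (2 * pi * (B * (1 / real K)))"
          unfolding norm_mult using b[OF n] A by (intro mult_mono) auto
      qed
      also have "\<dots> = 2 ^ j * (2 * pi * A * B / real K)" by simp
      also have "\<dots> \<le> 2 ^ m * (2 * pi * A * B / real K)"
        using ji A B by (intro mult_right_mono power_increasing) auto
      also have "\<dots> \<le> \<theta> / 2" using mesh K by (simp add: field_simps)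
      finally show ?thesis .
    qed
    have "real (card (H j i)) * (\<theta> / 2)\<^sup>2 \<le> real K * integral {0..1} (\<lambda>t. (norm (S j i t))\<^sup>2)"
    proof (rule card_mult_le_integral)
      show "continuous_on {0..1} (\<lambda>t. (norm (S j i t))\<^sup>2)"
        unfolding S_def by (intro continuous_intros)
      fix l t assume "l \<in> H j i" "t \<in> ?I l"
      then obtain t' where t': "t' \<in> ?I l" "\<theta> \<le> norm (S j i t')" by (auto simp: H_def)
      have "\<bar>t' - t\<bar> \<le> 1 / real K"
        using t'(1) \<open>t \<in> ?I l\<close> by (auto simp: add_divide_distrib)
      then have "norm (S j i t' - S j i t) \<le> \<theta> / 2" by (rule lip)
      then have "\<theta> / 2 \<le> norm (S j i t)"
        using t'(2) norm_triangle_ineq2[of "S j i t'" "S j i t"] by linarith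
      then show "(\<theta> / 2)\<^sup>2 \<le> (norm (S j i t))\<^sup>2"
        using \<theta> by (intro power_mono) auto
    qed (auto simp: H_def)
    also have "\<dots> \<le> real K * (4 * C * A\<^sup>2 * real (2 ^ j) * harm (2 ^ j))"
      unfolding S_def using sep b le A by (intro mult_left_mono mean_square_le) auto
    also have "\<dots> \<le> real K * (4 * C * A\<^sup>2 * real (2 ^ j) * (real m + 1))"
      using harm_power2_le[of j] ji C by (intro mult_left_mono) auto
    finally show ?thesis by (simp add: power_divide algebra_simps)
  qed
  have "card G \<le> card (\<Union>j\<le>m. \<Union>i<2 ^ (m - j). H j i)"
    using sub by (intro card_mono) (auto simp: H_def)
  also have "\<dots> \<le> (\<Sum>j\<le>m. \<Sum>i<2 ^ (m - j). card (H j i))"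
    by (intro order.trans[OF card_UN_le] sum_mono card_UN_le) auto
  finally have "real (card G) \<le> (\<Sum>j\<le>m. \<Sum>i<2 ^ (m - j). real (card (H j i)))"
    by (metis (no_types, lifting) of_nat_mono of_nat_sum sum.cong)
  then have "real (card G) * \<theta>\<^sup>2 \<le> (\<Sum>j\<le>m. \<Sum>i<2 ^ (m - j). real (card (H j i))) * \<theta>\<^sup>2"
    by (intro mult_right_mono) auto
  also have "\<dots> = (\<Sum>j\<le>m. \<Sum>i<2 ^ (m - j). real (card (H j i)) * \<theta>\<^sup>2)"
    by (simp add: sum_distrib_right)
  also have "\<dots> \<le> (\<Sum>j\<le>m. \<Sum>i<(2::nat) ^ (m - j). real K * (16 * C * A\<^sup>2 * (real m + 1)) * 2 ^ j)"
    by (intro sum_mono cardH) auto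
  \<comment> \<open>Level \<open>j\<close> has \<open>2 ^ (m - j)\<close> blocks of length
    \<open>2 ^ j\<close>, so all levels contribute equally.\<close>
  also have "\<dots> = (\<Sum>j\<le>m. real K * (16 * C * A\<^sup>2 * (real m + 1)) * 2 ^ m)"
    by (intro sum.cong refl) (simp add: power_add[symmetric])
  also have "\<dots> = real K * (16 * C * A\<^sup>2 * 2 ^ m * (real m + 1)\<^sup>2)"
    by (simp add: power2_eq_square)
  finally show ?thesis .
qed

section \<open>Dimension of the exceptional set\<close>

text \<open>\<open>A\<close> absorbs the finitely many \<open>n\<close> before the asymptotic bound
  sets in, as \<open>real n powr \<epsilon>\<close> is at least 1. Index 0 is excluded because
  \<open>0 powr \<epsilon> = 0\<close>.\<close>

lemma subpolynomial_bound:
  assumes "subpolynomial a" "0 < \<epsilon>"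
  obtains A where "0 < A" "\<And>n. 1 \<le> n \<Longrightarrow> norm (a n) \<le> A * real n powr \<epsilon>"
proof -
  obtain n0 where n0: "\<And>n. n \<ge> n0 \<Longrightarrow> norm (a n) \<le> real n powr \<epsilon>"
    using assms unfolding subpolynomial_def eventually_sequentially by blast
  define A where "A = 1 + (\<Sum>n<n0. norm (a n))"
  have A: "1 \<le> A" by (simp add: A_def sum_nonneg)
  have "norm (a n) \<le> A * real n powr \<epsilon>" if "1 \<le> n" for n
  proof (cases "n < n0")
    case True
    have "norm (a n) \<le> (\<Sum>n<n0. norm (a n))"
      using True by (intro member_le_sum) auto
    then have "norm (a n) \<le> A * 1" by (simp add: A_def)
    also have "\<dots> \<le> A * real n powr \<epsilon>"
      using A that assms by (intro mult_left_mono ge_one_powr_ge_zero) auto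
    finally show ?thesis .
  next
    case False
    then have "norm (a n) \<le> 1 * real n powr \<epsilon>" using n0 by simp
    also have "\<dots> \<le> A * real n powr \<epsilon>" using A by (intro mult_right_mono) auto
    finally show ?thesis .
  qed
  then show ?thesis using A by (intro that[of A]) auto
qed

text \<open>Absorbs the logarithmic losses into a small power of \<open>2 ^ m\<close>, by
  \<open>1 + x \<le> exp x\<close> at \<open>x = real m * (\<epsilon> * ln 2)\<close>.\<close>

lemma linear_le_powr:
  fixes \<epsilon> :: real
  assumes "0 < \<epsilon>"
  obtains C where "1 \<le> C" "\<And>m::nat. real m + 1 \<le> C * (2 ^ m) powr \<epsilon>"
proof
  let ?C = "1 + 1 / (\<epsilon> * ln 2)"
  have p: "0 < \<epsilon> * ln 2" using assms by simp
  then show "1 \<le> ?C" by simp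
  fix m :: nat
  have "real m + 1 \<le> (1 + 1 / u) * (1 + real m * u)" if "0 < u" for u :: real
  proof -
    have "(1 + 1 / u) * (1 + real m * u) = 1 + real m + real m * u + 1 / u"
      using that by (simp add: field_simps)
    then show ?thesis using that by simp
  qed
  then have "real m + 1 \<le> ?C * (1 + real m * (\<epsilon> * ln 2))" using p by blast
  also have "\<dots> \<le> ?C * exp (real m * (\<epsilon> * ln 2))"
    using exp_ge_add_one_self[of "real m * (\<epsilon> * ln 2)"] p by (intro mult_left_mono) auto
  also have "exp (real m * (\<epsilon> * ln 2)) = (2 ^ m) powr \<epsilon>"
    by (simp add: powr_def ln_realpow mult_ac)
  finally show "real m + 1 \<le> ?C * (2 ^ m) powr \<epsilon>" .
qed

lemma unit_interval_grid:
  fixes t :: real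
  assumes "t \<in> {0..1}" "0 < K"
  obtains l where "l < K" "t \<in> {real l / real K..(real l + 1) / real K}"
proof (cases "t = 1")
  case True
  \<comment> \<open>The floor used below would give the index \<open>K\<close> here, so
    \<open>t = 1\<close> goes to the last cell, which is closed.\<close>
  then show ?thesis using assms by (intro that[of "K - 1"]) (auto simp: of_nat_diff)
next
  case False
  define l where "l = nat \<lfloor>t * real K\<rfloor>"
  have "0 \<le> t * real K" "t * real K < real K" using assms False by auto
  then have l: "real l \<le> t * real K" "t * real K < real l + 1" "l < K"
    unfolding l_def by (simp_all add: nat_less_iff floor_less_iff)
  then show ?thesis using assms by (intro that[of l]) (auto simp: field_simps)
qed

text \<open>Level \<open>m\<close> of the cover handles the \<open>N\<close> with
  \<open>2 ^ (m - 1) \<le> N < 2 ^ m\<close>. The exponents are balanced so that its weight at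
  \<open>s\<close> decays geometrically in \<open>m\<close>.\<close>

lemma hausdorff_dim_large_poly_sums_le:
  fixes a :: "nat \<Rightarrow> complex" and Q :: "real poly"
  assumes Q: "degree Q \<noteq> 0" and a: "subpolynomial a" and \<alpha>: "1 / 2 < \<alpha>" "\<alpha> < 1"
  shows "hausdorff_dim {t \<in> {0..1}. \<exists>\<^sub>\<infinity>N. real N powr \<alpha> \<le> norm (\<Sum>n=1..N. a n * unit_exp (t * poly Q (real n)))}
           \<le> ereal (1 - (2 * \<alpha> - 1) / (real (degree Q) + 1 - \<alpha>))"
    (is "hausdorff_dim ?T \<le> _")
proof -
  define k where "k = degree Q"
  \<comment> \<open>The exponent of the number of cells: a derivative of size
    \<open>X ^ (k + 1)\<close> against a threshold of size \<open>X powr \<alpha>\<close>.\<close>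
  define \<kappa> where "\<kappa> = real k + 1 - \<alpha>"
  have k: "1 \<le> real k" using Q by (simp add: k_def)
  have \<kappa>: "1 < \<kappa>" using k \<alpha> by (simp add: \<kappa>_def)
  have "hausdorff_dim ?T \<le> ereal (1 - (2 * \<alpha> - 1) / \<kappa>)"
  proof (rule hausdorff_dim_leI[where ?s1.0 = 1])
    show "0 \<le> 1 - (2 * \<alpha> - 1) / \<kappa>" "1 - (2 * \<alpha> - 1) / \<kappa> < 1"
      using \<alpha> \<kappa> by (auto simp: field_simps)
    then show "hausdorff_measure s ?T = 0" if s: "1 - (2 * \<alpha> - 1) / \<kappa> < s" "s < 1" for s
    proof -
      \<comment> \<open>The numerator is \<kappa> times the excess of \<open>s\<close> over the
        critical exponent. The mesh will cost \<open>2 * \<epsilon>\<close> and the count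
        \<open>6 * \<epsilon>\<close>, which leaves the exponent
        \<open>- 8 * \<epsilon>\<close>.\<close>
      define \<epsilon> where "\<epsilon> = (2 * \<alpha> - 1 - \<kappa> * (1 - s)) / 16"
      have \<epsilon>16: "16 * \<epsilon> = 2 * \<alpha> - 1 - \<kappa> * (1 - s)" by (simp add: \<epsilon>_def)
      have \<epsilon>: "0 < \<epsilon>" using s \<kappa> by (simp add: \<epsilon>_def field_simps)
      have s0: "0 < s" using s \<open>0 \<le> 1 - (2 * \<alpha> - 1) / \<kappa>\<close> by linarith
      obtain A0 where A0: "0 < A0" "\<And>n. 1 \<le> n \<Longrightarrow> norm (a n) \<le> A0 * real n powr \<epsilon>"
        using subpolynomial_bound[OF a \<epsilon>] by blast
      obtain P where P: "1 \<le> P" "\<And>m::nat. real m + 1 \<le> P * (2 ^ m) powr \<epsilon>"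
        using linear_le_powr[OF \<epsilon>] by blast
      obtain B0 where B0: "0 \<le> B0"
        "\<And>n X. 1 \<le> X \<Longrightarrow> real n \<le> X \<Longrightarrow> \<bar>poly Q (real n)\<bar> \<le> B0 * X ^ k"
        using poly_nat_bound[of Q] unfolding k_def by blast
      obtain C where C: "\<And>m n :: nat. 1 + \<bar>real m - real n\<bar> \<le> C * (1 + \<bar>poly Q (real m) - poly Q (real n)\<bar>)"
        using poly_separation[OF Q] by blast
      have "0 < C" using C[of 0 0] by simp
      \<comment> \<open>Dyadic blocks start at 0 and the sums at 1; the value 0 also makes the
        growth bound hold at index 0.\<close>
      define b where "b n = (if n = 0 then 0 else a n)" for n
      define X where "X m = (2::real) ^ m" for m :: nat
      have X: "1 \<le> X m" for m by (simp add: X_def)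
      have P: "1 \<le> P" "real m + 1 \<le> P * X m powr \<epsilon>" for m using P by (simp_all add: X_def)
      \<comment> \<open>Level \<open>m\<close> has \<open>N \<ge> X m / 2\<close>, so a large sum is
        at least \<open>(X m / 2) powr \<alpha>\<close>; dividing by \<open>real m + 1\<close>
        allows for the dyadic decomposition.\<close>
      define \<theta> where "\<theta> m = (X m / 2) powr \<alpha> / (real m + 1)" for m
      have \<theta>: "0 < \<theta> m" for m using X[of m] by (simp add: \<theta>_def)
      have \<theta>_low: "X m powr (\<alpha> - \<epsilon>) / (2 powr \<alpha> * P) \<le> \<theta> m" for m
      proof -
        have "X m powr (\<alpha> - \<epsilon>) / (2 powr \<alpha> * P) = X m powr \<alpha> / (2 powr \<alpha>) / (P * X m powr \<epsilon>)"
          by (simp add: powr_diff)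
        also have "\<dots> \<le> X m powr \<alpha> / (2 powr \<alpha>) / (real m + 1)"
          using P(1) P(2)[of m] by (intro divide_left_mono) (auto intro!: mult_pos_pos)
        also have "\<dots> = \<theta> m" using X[of m] by (simp add: \<theta>_def powr_divide)
        finally show ?thesis .
      qed
      \<comment> \<open>The product is what \<open>mesh\<close> in \<open>card_grid_le\<close>
        requires; the summand 1 ensures \<open>X m \<le> real (K m)\<close> even when
        \<open>B0 = 0\<close>.\<close>
      define C1 where "C1 = 1 + 4 * pi * A0 * B0 * (2 powr \<alpha> * P)"
      have C1: "1 \<le> C1" using A0 B0 P by (simp add: C1_def)
      \<comment> \<open>One \<epsilon> comes from the coefficients, the other from the lower bound
        \<open>\<theta>_low\<close>.\<close>
      define K where "K m = nat \<lceil>C1 * X m powr (\<kappa> + 2 * \<epsilon>)\<rceil>" for m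
      have Klow: "C1 * X m powr (\<kappa> + 2 * \<epsilon>) \<le> real (K m)" for m
        unfolding K_def by (rule real_nat_ceiling_ge)
      have XK: "X m \<le> X m powr (\<kappa> + 2 * \<epsilon>)" for m
        using powr_mono[of 1 "\<kappa> + 2 * \<epsilon>" "X m"] X[of m] \<kappa> \<epsilon> by simp
      have KX: "X m \<le> real (K m)" for m
      proof -
        have "1 * X m \<le> C1 * X m powr (\<kappa> + 2 * \<epsilon>)"
          using C1 XK[of m] X[of m] by (intro mult_mono) auto
        then show ?thesis using Klow[of m] by simp
      qed
      have K: "0 < K m" for m using KX[of m] X[of m] by (cases "K m") auto
      have Kup: "real (K m) \<le> 2 * C1 * X m powr (\<kappa> + 2 * \<epsilon>)" for m
      proof -
        have "1 * 1 \<le> C1 * X m powr (\<kappa> + 2 * \<epsilon>)"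
          using C1 XK[of m] X[of m] by (intro mult_mono) auto
        then show ?thesis unfolding K_def by linarith
      qed
      define G where "G m = {l \<in> {..<K m}. \<exists>t\<in>{real l / real (K m)..(real l + 1) / real (K m)}. \<exists>N\<le>2 ^ m.
          (real m + 1) * \<theta> m \<le> norm (\<Sum>n<N. b n * unit_exp (t * poly Q (real n)))}" for m
      have count: "real (card (G m)) * (\<theta> m)\<^sup>2
          \<le> real (K m) * (16 * C * (A0 * X m powr \<epsilon>)\<^sup>2 * 2 ^ m * (real m + 1)\<^sup>2)" for m
      proof (rule card_grid_le[where q = "\<lambda>n. poly Q (real n)" and b = b and B = "B0 * X m ^ k"])
        have nX: "real n \<le> X m" if "n < 2 ^ m" for n
        proof -
          have "real n \<le> real (2 ^ m)" using that by (intro of_nat_mono) simp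
          then show ?thesis by (simp add: X_def)
        qed
        show "norm (b n) \<le> A0 * X m powr \<epsilon>" if n: "n < 2 ^ m" for n
        proof (cases "n = 0")
          case False
          then have "norm (b n) \<le> A0 * real n powr \<epsilon>" using A0(2) by (simp add: b_def)
          also have "\<dots> \<le> A0 * X m powr \<epsilon>"
            using A0(1) \<epsilon> nX[OF n] by (intro mult_left_mono powr_mono2) auto
          finally show ?thesis .
        qed (use A0 in \<open>simp add: b_def\<close>)
        show "\<bar>poly Q (real n)\<bar> \<le> B0 * X m ^ k" if "n < 2 ^ m" for n
          by (rule B0(2)[OF X nX[OF that]])
        have e: "X m powr \<epsilon> * X m ^ k * X m = X m powr (\<kappa> + 2 * \<epsilon>) * X m powr (\<alpha> - \<epsilon>)"
        proof -
          have "X m powr \<epsilon> * X m powr real k * X m powr 1 = X m powr (\<kappa> + 2 * \<epsilon>) * X m powr (\<alpha> - \<epsilon>)"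
            unfolding powr_add[symmetric] \<kappa>_def by (rule arg_cong[where f = "\<lambda>x. X m powr x"]) simp
          then show ?thesis using X[of m] by (simp add: powr_realpow)
        qed
        have "4 * pi * (A0 * X m powr \<epsilon>) * (B0 * X m ^ k) * 2 ^ m
            = 4 * pi * A0 * B0 * (X m powr \<epsilon> * X m ^ k * X m)"
          by (simp add: X_def)
        also have "\<dots> = (4 * pi * A0 * B0 * (2 powr \<alpha> * P)) * X m powr (\<kappa> + 2 * \<epsilon>) * (X m powr (\<alpha> - \<epsilon>) / (2 powr \<alpha> * P))"
          unfolding e using P(1) by simp
        also have "\<dots> \<le> (C1 * X m powr (\<kappa> + 2 * \<epsilon>)) * \<theta> m"
          using \<theta>_low[of m] C1 P(1)
          by (intro mult_mono mult_right_mono) (auto simp: C1_def)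
        also have "\<dots> \<le> real (K m) * \<theta> m"
          using Klow[of m] \<theta>[of m] by (intro mult_right_mono) auto
        finally show "4 * pi * (A0 * X m powr \<epsilon>) * (B0 * X m ^ k) * 2 ^ m \<le> real (K m) * \<theta> m" .
      qed (use C \<theta> K G_def in auto)
      \<comment> \<open>Two factors \<open>P\<close> come from the squared
        \<open>real m + 1\<close>, two from the squared lower bound for \<theta>.\<close>
      define D where "D = 16 * C * A0\<^sup>2 * (2 powr \<alpha>)\<^sup>2 * P ^ 4"
      have card_le: "real (card (G m)) \<le> real (K m) * (D * X m powr (1 + 6 * \<epsilon> - 2 * \<alpha>))" for m
      proof -
        let ?z = "X m powr (\<alpha> - \<epsilon>) / (2 powr \<alpha> * P)"
        have regroup: "u * (16 * c * (v * e)\<^sup>2 * x * (p * e)\<^sup>2) = u * (16 * c * v\<^sup>2 * p\<^sup>2 * (e ^ 4 * x))"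
          for u c v e x p :: real
          by (simp add: power_mult_distrib power4_eq_xxxx power2_eq_square)
        have z: "0 < ?z" using X[of m] P(1) by simp
        have "real (card (G m)) * ?z\<^sup>2 \<le> real (card (G m)) * (\<theta> m)\<^sup>2"
          using \<theta>_low[of m] z by (intro mult_left_mono power_mono) auto
        also note count[of m]
        also have "real (K m) * (16 * C * (A0 * X m powr \<epsilon>)\<^sup>2 * 2 ^ m * (real m + 1)\<^sup>2)
            \<le> real (K m) * (16 * C * (A0 * X m powr \<epsilon>)\<^sup>2 * 2 ^ m * (P * X m powr \<epsilon>)\<^sup>2)"
          using P(2)[of m] \<open>0 < C\<close> by (intro mult_left_mono power_mono) auto
        also have "\<dots> = real (K m) * (16 * C * A0\<^sup>2 * P\<^sup>2 * ((X m powr \<epsilon>) ^ 4 * X m))"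
          unfolding regroup[symmetric] by (simp only: X_def)
        \<comment> \<open>Coefficients and logarithms give \<open>4 * \<epsilon>\<close>; division
          by the squared lower bound for \<theta> adds \<open>2 * \<epsilon>\<close>.\<close>
        also have "(X m powr \<epsilon>) ^ 4 * X m = X m powr (1 + 6 * \<epsilon> - 2 * \<alpha>) * (X m powr (\<alpha> - \<epsilon>))\<^sup>2"
        proof -
          have "X m powr (\<epsilon> * 4) * X m powr 1 = X m powr (1 + 6 * \<epsilon> - 2 * \<alpha>) * X m powr ((\<alpha> - \<epsilon>) * 2)"
            unfolding powr_add[symmetric] by (rule arg_cong[where f = "\<lambda>x. X m powr x"]) simp
          moreover have "(X m powr \<epsilon>) ^ 4 = X m powr (\<epsilon> * 4)" "(X m powr (\<alpha> - \<epsilon>))\<^sup>2 = X m powr ((\<alpha> - \<epsilon>) * 2)"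
            using X[of m] powr_realpow[of "X m powr \<epsilon>" 4] powr_realpow[of "X m powr (\<alpha> - \<epsilon>)" 2]
            by (simp_all add: powr_powr)
          ultimately show ?thesis using X[of m] by simp
        qed
        also have "real (K m) * (16 * C * A0\<^sup>2 * P\<^sup>2 * (X m powr (1 + 6 * \<epsilon> - 2 * \<alpha>) * (X m powr (\<alpha> - \<epsilon>))\<^sup>2))
            = real (K m) * (D * X m powr (1 + 6 * \<epsilon> - 2 * \<alpha>)) * ?z\<^sup>2"
          using P(1) by (simp add: D_def power_divide power_mult_distrib power4_eq_xxxx power2_eq_square)
        finally show ?thesis using z by (simp only: mult_le_cancel_right zero_less_power)
      qed
      have "0 < D" using \<open>0 < C\<close> A0(1) P(1) by (simp add: D_def)
      have term_le: "real (card (G m)) * (1 / real (K m)) powr s \<le> 2 * C1 * D * (2 powr (- 8 * \<epsilon>)) ^ m" for m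
      proof -
        have Kp: "0 < real (K m)" using K by simp
        have "real (card (G m)) * (1 / real (K m)) powr s
            \<le> real (K m) * (D * X m powr (1 + 6 * \<epsilon> - 2 * \<alpha>)) * (1 / real (K m)) powr s"
          using card_le[of m] by (intro mult_right_mono) auto
        also have "\<dots> = real (K m) powr (1 - s) * (D * X m powr (1 + 6 * \<epsilon> - 2 * \<alpha>))"
          using Kp by (simp add: powr_divide powr_diff)
        also have "\<dots> \<le> (2 * C1 * X m powr (\<kappa> * (1 - s) + 2 * \<epsilon>)) * (D * X m powr (1 + 6 * \<epsilon> - 2 * \<alpha>))"
        proof (rule mult_right_mono)
          have "real (K m) powr (1 - s) \<le> (2 * C1 * X m powr (\<kappa> + 2 * \<epsilon>)) powr (1 - s)"
            using Kup[of m] Kp s by (intro powr_mono2) auto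
          also have "\<dots> = (2 * C1) powr (1 - s) * X m powr ((\<kappa> + 2 * \<epsilon>) * (1 - s))"
            using C1 by (simp add: powr_mult powr_powr)
          also have "\<dots> \<le> (2 * C1) powr 1 * X m powr (\<kappa> * (1 - s) + 2 * \<epsilon>)"
          proof (intro mult_mono powr_mono)
            have "2 * \<epsilon> * (1 - s) \<le> 2 * \<epsilon> * 1" using \<epsilon> s0 by (intro mult_left_mono) auto
            then show "(\<kappa> + 2 * \<epsilon>) * (1 - s) \<le> \<kappa> * (1 - s) + 2 * \<epsilon>" by (simp add: distrib_right)
          qed (use C1 X s0 in auto)
          finally show "real (K m) powr (1 - s) \<le> 2 * C1 * X m powr (\<kappa> * (1 - s) + 2 * \<epsilon>)"
            using C1 by simp
        qed (use \<open>0 < D\<close> in auto)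
        also have "\<dots> = 2 * C1 * D * (X m powr (\<kappa> * (1 - s) + 2 * \<epsilon>) * X m powr (1 + 6 * \<epsilon> - 2 * \<alpha>))"
          by simp
        also have "X m powr (\<kappa> * (1 - s) + 2 * \<epsilon>) * X m powr (1 + 6 * \<epsilon> - 2 * \<alpha>) = X m powr (- 8 * \<epsilon>)"
          unfolding powr_add[symmetric] by (rule arg_cong[where f = "\<lambda>x. X m powr x"]) (use \<epsilon>16 in linarith)
        also have "X m powr (- 8 * \<epsilon>) = (2 powr (- 8 * \<epsilon>)) ^ m"
          by (simp add: X_def powr_realpow[symmetric] powr_powr mult.commute)
        finally show ?thesis .
      qed
      show ?thesis
      proof (rule hausdorff_measure_zero_limsup_cover[OF s0,
            where J = G and d = "\<lambda>m. 1 / real (K m)" and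
              U = "\<lambda>m l. {real l / real (K m)..(real l + 1) / real (K m)}"])
        show "diameter {real l / real (K m)..(real l + 1) / real (K m)} \<le> 1 / real (K m)" for m l
          using K[of m] by (simp add: diameter_closed_interval diff_divide_distrib[symmetric] divide_right_mono)
        have lim: "(\<lambda>m. (1 / 2 :: real) ^ m) \<longlonglongrightarrow> 0" by (rule LIMSEQ_power_zero) simp
        have "1 / real (K m) \<le> (1 / 2) ^ m" for m
          using KX[of m] X[of m] by (simp add: X_def power_divide frac_le)
        then show "(\<lambda>m. 1 / real (K m)) \<longlonglongrightarrow> 0"
          by (intro real_tendsto_sandwich[OF _ _ tendsto_const lim] always_eventually allI) simp_all
        have "summable (\<lambda>m. 2 * C1 * D * (2 powr (- 8 * \<epsilon>)) ^ m)"
          using \<epsilon> by (intro summable_mult summable_geometric) (simp add: powr_less_one)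
        then show "summable (\<lambda>m. real (card (G m)) * (1 / real (K m)) powr s)"
          by (rule summable_comparison_test'[where N = 0]) (use term_le in auto)
        show "\<exists>m\<ge>m0. \<exists>l\<in>G m. t \<in> {real l / real (K m)..(real l + 1) / real (K m)}"
          if "t \<in> ?T" for t m0
        proof -
          obtain N where N: "2 ^ m0 \<le> N"
            "real N powr \<alpha> \<le> norm (\<Sum>n=1..N. a n * unit_exp (t * poly Q (real n)))"
            using \<open>t \<in> ?T\<close> unfolding INFM_nat_le by blast
          have "1 \<le> N" using N(1) by (metis le_trans one_le_numeral one_le_power)
          then obtain r where r: "2 ^ r \<le> N" "N < 2 ^ (r + 1)"
            using ex_power_ivl1[of 2 N] by auto
          \<comment> \<open>With this shift \<open>Suc N \<le> 2 ^ m\<close>, as \<open>G\<close>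
            demands, while \<open>X m / 2 = 2 ^ r\<close> is still at most \<open>N\<close>.\<close>
          define m where "m = r + 1"
          have "(2::nat) ^ m0 < 2 ^ m" using N(1) r(2) unfolding m_def by (rule le_less_trans)
          then have "m0 \<le> m" by simp
          obtain l where l: "l < K m" "t \<in> {real l / real (K m)..(real l + 1) / real (K m)}"
            using unit_interval_grid[of t "K m"] \<open>t \<in> ?T\<close> K by blast
          have "(real m + 1) * \<theta> m = (2 ^ r) powr \<alpha>"
            by (simp add: \<theta>_def X_def m_def add_pos_nonneg add_eq_0_iff)
          also have "\<dots> \<le> real N powr \<alpha>"
          proof (rule powr_mono2)
            show "(2::real) ^ r \<le> real N"
              using of_nat_mono[OF r(1), where 'a = real] by simp
          qed (use \<alpha> in auto)
          also have "\<dots> \<le> norm (\<Sum>n=1..N. a n * unit_exp (t * poly Q (real n)))" by (rule N(2))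
          \<comment> \<open>The vanishing term at 0 is added, which gives the initial segment of
            length \<open>Suc N\<close>.\<close>
          also have "(\<Sum>n=1..N. a n * unit_exp (t * poly Q (real n))) = (\<Sum>n<Suc N. b n * unit_exp (t * poly Q (real n)))"
            by (rule sum.mono_neutral_cong_left) (auto simp: b_def)
          finally have "l \<in> G m"
            unfolding G_def using l r(2) by (auto simp: m_def intro!: bexI[of _ t] exI[of _ "Suc N"])
          then show ?thesis using \<open>m0 \<le> m\<close> l by blast
        qed
      qed (auto simp: G_def)
    qed
  qed
  then show ?thesis by (simp add: \<kappa>_def k_def)
qed

section \<open>Restriction to the segment\<close>

theorem corollary2p18:
  fixes a :: "nat \<Rightarrow> complex" and \<alpha> :: real and k :: nat
    and \<omega> :: "real ^ 'n::{finite,linorder}"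
  assumes "CARD('n) \<ge> 2"
    and "subpolynomial a"
    and "1 / 2 < \<alpha>" and "\<alpha> < 1"
    and "k \<in> {1..CARD('n)}"
    and "\<forall>j \<in> {k<..CARD('n)}. coord \<omega> j = 0"
    and "coord \<omega> k \<noteq> 0"
    and "norm \<omega> = 1"
  shows "hausdorff_dim (large_sums a \<alpha> \<inter> segment_from_0 \<omega>)
           \<le> ereal (1 - (2 * \<alpha> - 1) / (real k + 1 - \<alpha>))"
proof -
  define Q where "Q = (\<Sum>j=1..CARD('n). monom (coord \<omega> j) j)"
  have coeff: "coeff Q i = (if i \<in> {1..CARD('n)} then coord \<omega> i else 0)" for i
    by (simp add: Q_def coeff_sum)
  \<comment> \<open>The last nonzero coordinate of \<omega> is the leading coefficient, so the bound
    depends on \<open>k\<close> and not on the dimension.\<close>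
  have deg: "degree Q = k"
  proof (rule antisym)
    show "degree Q \<le> k" using assms by (intro degree_le) (auto simp: coeff)
    show "k \<le> degree Q" using assms by (intro le_degree) (simp add: coeff)
  qed
  have "poly Q x = (\<Sum>j=1..CARD('n). coord \<omega> j * x ^ j)" for x
    by (simp add: Q_def poly_sum poly_monom)
  then have weyl: "weyl_sum a (t *\<^sub>R \<omega>) N = (\<Sum>n=1..N. a n * unit_exp (t * poly Q (real n)))" for t N
    by (simp add: weyl_sum_def coord_def sum_distrib_left mult.assoc)
  let ?T = "{t \<in> {0..1}. \<exists>\<^sub>\<infinity>N. real N powr \<alpha> \<le> norm (\<Sum>n=1..N. a n * unit_exp (t * poly Q (real n)))}"
  have "hausdorff_dim (large_sums a \<alpha> \<inter> segment_from_0 \<omega>) \<le> hausdorff_dim ?T"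
  \<comment> \<open>As \<omega> is a unit vector, the parametrisation of the segment is an
    isometry.\<close>
  proof (rule hausdorff_dim_lipschitz_image_le[where f = "\<lambda>t. t *\<^sub>R \<omega>"])
    show "dist (x *\<^sub>R \<omega>) (y *\<^sub>R \<omega>) \<le> dist x y" for x y
      using \<open>norm \<omega> = 1\<close> by (simp add: dist_norm scaleR_diff_left[symmetric])
    show "large_sums a \<alpha> \<inter> segment_from_0 \<omega> \<subseteq> (\<lambda>t. t *\<^sub>R \<omega>) ` ?T"
      by (auto simp: large_sums_def segment_from_0_def weyl)
  qed
  also have "\<dots> \<le> ereal (1 - (2 * \<alpha> - 1) / (real (degree Q) + 1 - \<alpha>))"
    using assms deg by (intro hausdorff_dim_large_poly_sums_le) auto
  finally show ?thesis by (simp add: deg)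
qed

end
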